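(* Let $(\mathcal{X},d)$ be a complete metric space and $f\colon\mathcal{X}\to\mathbb{R}\cup\{+\infty\}$ a closed function. Consider a sequence of points $x_k\in\mathcal{X}$ with $f(x_k)$ finite and closed functions $f_{x_k}\colon\mathcal{X}\to\mathbb{R}\cup\{+\infty\}$ such that $x_{k+1}$ is a minimizer of $f_{x_k}$ for every $k$, and $d(x_{k+1},x_k)\to 0$. Suppose moreover that $$|f_{x_k}(y)-f(y)|\leq\omega(d(y,x_k))\quad\text{for all indices } k \text{ and all points } y\in\mathcal{X},$$ where $\omega$ is a proper growth function. If $(x^*,f(x^* ))\in\mathcal{X}\times\mathbb{R}$ is a limit point (i.e. the limit of a subsequence) of the sequence $(x_k,f(x_k))$, then $x^*$ is stationary for $f$.
   Context: A function on a metric space is called closed if it is lower-semicontinuous. A growth function is a differentiable function $\omega\colon[0,\infty)\to[0,\infty)$ (one-sided derivative at $0$) with $\omega(0)=\omega'(0)=0$ and $\omega'>0$ on $(0,\infty)$; it is proper if in addition $\lim_{t\to0^+}\omega'(t)=\lim_{t\to 0^+}\omega(t)/\omega'(t)=0$. The slope of $f$ at a point $\bar x$ with $f(\bar x)$ finite is $|\nabla f|(\bar x):=\limsup_{x\to\bar x,\,x\ne\bar x}\frac{(f(\bar x)-f(x))^+}{d(\bar x,x)}$, where $r^+=\max\{0,r\}$ (it is $0$ if $\bar x$ is isolated). The limiting slope is $\overline{|\nabla f|}(\bar x):=\liminf_{x\to\bar x,\,f(x)\to f(\bar x)}|\nabla f|(x)$, where $x=\bar x$ is allowed in the liminf. A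 point $\bar x$ is stationary for $f$ if $\overline{|\nabla f|}(\bar x)=0$. The inequality $|f_{x_k}(y)-f(y)|\le\omega(d(y,x_k))$ is understood to mean that $f_{x_k}(y)$ and $f(y)$ are either both $+\infty$ or both finite and satisfying the inequality. *)

theory Defs
  imports "HOL-Analysis.Analysis"
begin

definition lower_semicontinuous :: "('a::topological_space \<Rightarrow> ereal) \<Rightarrow> bool" where
  "lower_semicontinuous f \<longleftrightarrow> (\<forall>x. f x \<le> Liminf (at x) f)"

definition closed_function :: "('a::metric_space \<Rightarrow> ereal) \<Rightarrow> bool" where
  "closed_function f \<longleftrightarrow> lower_semicontinuous f"

(* Derivative of a function on [0,\<infinity>); one-sided at 0. Values of w at negative arguments
   are irrelevant. *)
definition growth_deriv :: "(real \<Rightarrow> real) \<Rightarrow> real \<Rightarrow> real" where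
  "growth_deriv w t = vector_derivative w (at t within {0..})"

definition growth_function :: "(real \<Rightarrow> real) \<Rightarrow> bool" where
  "growth_function w \<longleftrightarrow>
     (\<forall>t\<ge>0. 0 \<le> w t) \<and> w differentiable_on {0..} \<and>
     w 0 = 0 \<and> growth_deriv w 0 = 0 \<and> (\<forall>t>0. 0 < growth_deriv w t)"

definition proper_growth_function :: "(real \<Rightarrow> real) \<Rightarrow> bool" where
  "proper_growth_function w \<longleftrightarrow> growth_function w \<and>
     (growth_deriv w \<longlongrightarrow> 0) (at_right 0) \<and>
     ((\<lambda>t. w t / growth_deriv w t) \<longlongrightarrow> 0) (at_right 0)"

(* The slope is meant for points where f is finite; elsewhere it is set to \<infinity>. Isolated points
   are treated separately because the Limsup along the trivial filter is -\<infinity>, not 0. *)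
definition slope :: "('a::metric_space \<Rightarrow> ereal) \<Rightarrow> 'a \<Rightarrow> ereal" where
  "slope f x =
     (if \<bar>f x\<bar> = \<infinity> then \<infinity>
      else if at x = bot then 0
      else Limsup (at x) (\<lambda>y. max 0 (f x - f y) / ereal (dist x y)))"

(* The filter expresses y \<rightarrow> x together with f y \<rightarrow> f x, with y = x allowed. If f x is finite,
   then so is f y eventually along it, and the value of slope off the domain plays no role. *)
definition limiting_slope :: "('a::metric_space \<Rightarrow> ereal) \<Rightarrow> 'a \<Rightarrow> ereal" where
  "limiting_slope f x = Liminf (inf (nhds x) (filtercomap f (nhds (f x)))) (slope f)"

definition stationary_point :: "('a::metric_space \<Rightarrow> ereal) \<Rightarrow> 'a \<Rightarrow> bool" where
  "stationary_point f x \<longleftrightarrow> \<bar>f x\<bar> \<noteq> \<infinity> \<and> limiting_slope f x = 0"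

end

theory Submission
  imports Defs
begin

text \<open>
  Since the model \<open>fx k\<close> is within \<open>\<omega> (dist y (x k))\<close> of \<open>f\<close>, the point \<open>x (Suc k)\<close> minimizes
  \<open>h y = f y + \<omega> (dist y (x k))\<close> up to the error \<open>2 * \<omega> (dist (x (Suc k)) (x k))\<close>. For fixed
  \<open>\<epsilon> > 0\<close>, Ekeland's variational principle gives a point \<open>z k\<close> with
  \<open>\<epsilon> * dist (x (Suc k)) (z k) \<le> 2 * \<omega> (dist (x (Suc k)) (x k))\<close> at which \<open>h\<close> has slope at most
  \<open>\<epsilon>\<close>, so that \<open>f\<close> has slope at most a little more than \<open>\<epsilon> + \<omega>' (dist (z k) (x k))\<close>. Along the
  subsequence the points \<open>z k\<close> converge to \<open>xstar\<close>, and their values converge to \<open>f xstar\<close> by lower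
  semicontinuity.
\<close>

section \<open>Lower semicontinuity through neighbourhoods\<close>

lemma lower_semicontinuousD:
  assumes "lower_semicontinuous f" and "c < f x"
  shows "\<forall>\<^sub>F y in nhds x. c < f y"
proof -
  have "c < Liminf (at x) f"
    using assms unfolding lower_semicontinuous_def by (meson less_le_trans)
  then have "\<forall>\<^sub>F y in at x. c < f y"
    by (rule less_LiminfD)
  then show ?thesis
    using assms(2) by (simp add: eventually_nhds_conv_at)
qed

text \<open>Real levels suffice because the reals are dense in the extended reals. This keeps
  infinite levels out of \<open>lower_semicontinuous_add_real\<close>.\<close>

lemma lower_semicontinuousI:
  assumes "\<And>x c. ereal c < f x \<Longrightarrow> \<forall>\<^sub>F y in nhds x. ereal c < f y"
  shows "lower_semicontinuous f"
  unfolding lower_semicontinuous_def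
proof
  fix x
  show "f x \<le> Liminf (at x) f"
  proof (rule ccontr)
    assume "\<not> f x \<le> Liminf (at x) f"
    then obtain c where c: "Liminf (at x) f < ereal c" "ereal c < f x"
      using ereal_dense2 by (meson not_le)
    from assms[OF c(2)] have "\<forall>\<^sub>F y in at x. ereal c < f y"
      by (simp add: eventually_nhds_conv_at)
    then have "ereal c \<le> Liminf (at x) f"
      by (intro Liminf_bounded) (auto elim: eventually_mono)
    with c(1) show False by simp
  qed
qed

lemma lower_semicontinuous_add_real:
  fixes f :: "'a::topological_space \<Rightarrow> ereal"
  assumes f: "lower_semicontinuous f" and g: "continuous_on UNIV g"
  shows "lower_semicontinuous (\<lambda>y. f y + ereal (g y))"
proof (rule lower_semicontinuousI)
  fix x c assume c: "ereal c < f x + ereal (g x)"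
  then have "ereal (c - g x) < f x"
    by (cases "f x") auto
  \<comment> \<open>The level \<open>c\<close> is split as \<open>b + (c - b)\<close>: near
    \<open>x\<close>, \<open>f\<close> stays above the first summand and \<open>g\<close> above the
    second.\<close>
  then obtain b where b: "ereal (c - g x) < ereal b" "ereal b < f x"
    using ereal_dense2 by blast
  have "(g \<longlongrightarrow> g x) (nhds x)"
    using g by (simp add: continuous_on_def tendsto_nhds_iff)
  moreover have "c - b < g x"
    using b(1) by simp
  ultimately have "\<forall>\<^sub>F y in nhds x. c - b < g y"
    by (rule order_tendstoD)
  moreover have "\<forall>\<^sub>F y in nhds x. ereal b < f y"
    using f b(2) by (rule lower_semicontinuousD)
  ultimately show "\<forall>\<^sub>F y in nhds x. ereal c < f y + ereal (g y)"
  proof eventually_elim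
    case (elim y)
    then show ?case by (cases "f y") auto
  qed
qed

text \<open>A level strictly between \<open>c\<close> and \<open>f x\<close> would eventually lie
  below \<open>f (u n)\<close> and above \<open>v n\<close>. In Ekeland's principle this carries
  estimates over to the limit point.\<close>

lemma lower_semicontinuous_limit_le:
  assumes f: "lower_semicontinuous f" and u: "(u \<longlongrightarrow> x) F" and "F \<noteq> bot"
    and le: "\<forall>\<^sub>F n in F. f (u n) \<le> v n" and v: "(v \<longlongrightarrow> c) F"
  shows "f x \<le> c"
proof (rule ccontr)
  assume "\<not> f x \<le> c"
  then obtain b where b: "c < b" "b < f x"
    using dense by (meson not_le)
  have "\<forall>\<^sub>F n in F. b < f (u n)"
    using eventually_compose_filterlim[OF lower_semicontinuousD[OF f b(2)] u] .
  moreover have "\<forall>\<^sub>F n in F. v n < b"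
    using v b(1) by (rule order_tendstoD)
  ultimately have "\<forall>\<^sub>F n in F. False"
    using le by eventually_elim auto
  with \<open>F \<noteq> bot\<close> show False by simp
qed

section \<open>Ekeland's variational principle\<close>

text \<open>A greedy descent from \<open>x0\<close>, in which every move of length \<open>d\<close>
  lowers \<open>f\<close> by at least \<open>\<epsilon> * d\<close>, converges by completeness. From
  its limit no further such move is possible.\<close>

theorem ekeland_variational_principle:
  fixes f :: "'a::complete_space \<Rightarrow> ereal"
  assumes lsc: "lower_semicontinuous f"
    and lower: "\<And>y. ereal m \<le> f y"
    and x0: "f x0 \<noteq> \<infinity>"
    and \<epsilon>: "0 < \<epsilon>"
  obtains z where "f z + ereal (\<epsilon> * dist x0 z) \<le> f x0"
    and "\<And>y. f z \<le> f y + ereal (\<epsilon> * dist z y)"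
proof -
  \<comment> \<open>\<open>S u\<close> collects the admissible moves from \<open>u\<close>. Being
    reflexive and transitive, the relation acts as an order whose minimal element is sought.\<close>
  define S where "S u = {y. f y + ereal (\<epsilon> * dist u y) \<le> f u}" for u
  have S_refl: "u \<in> S u" for u
    by (simp add: S_def zero_ereal_def[symmetric])
  have S_trans: "w \<in> S u" if "v \<in> S u" "w \<in> S v" for u v w
  proof -
    have "\<epsilon> * dist u w \<le> \<epsilon> * dist u v + \<epsilon> * dist v w"
      using \<epsilon> dist_triangle[of u w v] by (simp flip: distrib_left)
    with that lower[of u] lower[of v] lower[of w] show ?thesis
      unfolding S_def by (cases "f u"; cases "f v"; cases "f w") auto
  qed
  have S_le: "f v \<le> f u" if "v \<in> S u" for u v
  proof -
    have "0 \<le> \<epsilon> * dist u v" using \<epsilon> by simp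
    with that lower[of u] lower[of v] show ?thesis
      unfolding S_def by (cases "f u"; cases "f v") auto
  qed
  have step: "\<exists>v. f v \<noteq> \<infinity> \<and> v \<in> S u \<and> (\<forall>y\<in>S u. f v \<le> f y + ereal ((1/2)^n))"
    if "f u \<noteq> \<infinity>" for u and n :: nat
  proof -
    have I: "ereal m \<le> (INF y\<in>S u. f y)" "(INF y\<in>S u. f y) \<le> f u"
      using lower S_refl by (auto intro: INF_greatest INF_lower)
    \<comment> \<open>The bounds in \<open>I\<close> make the infimum finite, so adding a positive
      number increases it strictly and a near-minimizer exists.\<close>
    then have "(INF y\<in>S u. f y) < (INF y\<in>S u. f y) + ereal ((1/2)^n)"
      using that by (cases "INF y\<in>S u. f y") auto
    then obtain v where v: "v \<in> S u" "f v < (INF y\<in>S u. f y) + ereal ((1/2)^n)"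
      by (meson INF_less_iff)
    have "f v \<le> f y + ereal ((1/2)^n)" if "y \<in> S u" for y
      using v(2) INF_lower[OF that, of f] by (meson add_right_mono less_imp_le order_trans)
    moreover have "f v \<noteq> \<infinity>"
      using S_le[OF v(1)] that by auto
    ultimately show ?thesis using v(1) by blast
  qed
  have "\<exists>u. \<forall>n. (f (u n) \<noteq> \<infinity> \<and> (n = 0 \<longrightarrow> u n = x0)) \<and>
      (u (Suc n) \<in> S (u n) \<and> (\<forall>y\<in>S (u n). f (u (Suc n)) \<le> f y + ereal ((1/2)^n)))"
    using x0 step by (intro dependent_nat_choice) auto
  then obtain u where u_fin: "\<And>n. f (u n) \<noteq> \<infinity>" and u0: "u 0 = x0"
    and u_S: "\<And>n. u (Suc n) \<in> S (u n)"
    and u_min: "\<And>n y. y \<in> S (u n) \<Longrightarrow> f (u (Suc n)) \<le> f y + ereal ((1/2)^n)"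
    by blast
  have chain: "u k \<in> S (u n)" if "n \<le> k" for n k
    using that by (induction k rule: dec_induct) (auto intro: S_refl S_trans u_S)
  define F where "F n = real_of_ereal (f (u n))" for n
  have F: "f (u n) = ereal (F n)" for n
    using u_fin[of n] lower[of "u n"] unfolding F_def by (cases "f (u n)") auto
  have F_dist: "\<epsilon> * dist (u n) (u k) \<le> F n - F k" if "n \<le> k" for n k
    using chain[OF that] by (simp add: S_def F)
  have "decseq F"
    using S_le[OF chain] by (simp add: decseq_def F)
  moreover have "m \<le> F n" for n
    using lower[of "u n"] by (simp add: F)
  ultimately obtain L where L: "F \<longlonglongrightarrow> L"
    using decseq_convergent by blast
  \<comment> \<open>Distances are controlled by the drops of \<open>F\<close>, and \<open>F\<close>
    converges.\<close>
  have "Cauchy u"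
  proof (rule metric_CauchyI)
    fix e :: real assume "0 < e"
    then have "0 < \<epsilon> * e" using \<epsilon> by simp
    then obtain M where M: "\<And>i j. M \<le> i \<Longrightarrow> M \<le> j \<Longrightarrow> dist (F i) (F j) < \<epsilon> * e"
      using metric_CauchyD[OF LIMSEQ_imp_Cauchy[OF L]] by blast
    have *: "dist (u i) (u j) < e" if "M \<le> i" "i \<le> j" for i j
    proof -
      have "\<epsilon> * dist (u i) (u j) < \<epsilon> * e"
        using F_dist[OF that(2)] M[of i j] that by (simp add: dist_real_def)
      then show ?thesis using \<epsilon> by simp
    qed
    show "\<exists>M. \<forall>i\<ge>M. \<forall>j\<ge>M. dist (u i) (u j) < e"
      by (metis * dist_commute nle_le)
  qed
  then obtain z where z: "u \<longlonglongrightarrow> z"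
    using Cauchy_convergent convergent_def by blast
  have z_S: "z \<in> S (u n)" for n
  proof -
    have "f z \<le> ereal (F n - \<epsilon> * dist (u n) z)"
    proof (rule lower_semicontinuous_limit_le[OF lsc z])
      show "\<forall>\<^sub>F k in sequentially. f (u k) \<le> ereal (F n - \<epsilon> * dist (u n) (u k))"
        using eventually_ge_at_top[of n] by eventually_elim (use F_dist F in fastforce)
      show "(\<lambda>k. ereal (F n - \<epsilon> * dist (u n) (u k))) \<longlonglongrightarrow> ereal (F n - \<epsilon> * dist (u n) z)"
        by (intro tendsto_intros z)
    qed simp
    then show ?thesis
      using lower[of z] by (cases "f z") (auto simp: S_def F)
  qed
  \<comment> \<open>By transitivity \<open>y\<close> lies in every \<open>S (u n)\<close>, so it
    competes in each greedy choice; the tolerances \<open>(1/2)^n\<close> vanish in the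
    limit.\<close>
  have z_min: "f z \<le> f y" if "y \<in> S z" for y
  proof -
    have y: "f (u (Suc n)) \<le> f y + ereal ((1/2)^n)" for n
      using S_trans[OF z_S that] by (rule u_min)
    have "f y \<noteq> \<infinity>"
      using S_le[OF that] S_le[OF z_S[of 0]] u_fin[of 0] by auto
    then obtain b where b: "f y = ereal b"
      using lower[of y] by (cases "f y") auto
    have "(\<lambda>n. ereal (b + (1/2)^n)) \<longlonglongrightarrow> ereal (b + 0)"
      by (intro tendsto_intros LIMSEQ_power_zero) auto
    moreover have "\<forall>\<^sub>F n in sequentially. f (u (Suc n)) \<le> ereal (b + (1/2)^n)"
      using y by (simp add: b)
    ultimately show ?thesis
      using lower_semicontinuous_limit_le[OF lsc LIMSEQ_Suc[OF z]] b by fastforce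
  qed
  show thesis
  proof
    show "f z + ereal (\<epsilon> * dist x0 z) \<le> f x0"
      using z_S[of 0] by (simp add: S_def u0)
    show "f z \<le> f y + ereal (\<epsilon> * dist z y)" for y
    proof (rule ccontr)
      \<comment> \<open>A violation would make \<open>y\<close> an admissible move from
        \<open>z\<close> with \<open>f y < f z\<close>, against \<open>z_min\<close>.\<close>
      assume less: "\<not> f z \<le> f y + ereal (\<epsilon> * dist z y)"
      then have "f z \<le> f y"
        by (intro z_min) (simp add: S_def)
      moreover have "0 \<le> \<epsilon> * dist z y"
        using \<epsilon> by simp
      ultimately show False
        using less by (cases "f y"; cases "f z") auto
    qed
  qed
qed

section \<open>Bounds for the slope\<close>

lemma slope_nonneg: "0 \<le> slope f x"
proof -
  have "0 \<le> Limsup (at x) (\<lambda>y. max 0 (f x - f y) / ereal (dist x y))" if "at x \<noteq> bot"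
    using that by (intro le_Limsup always_eventually allI zero_le_divide_ereal) auto
  then show ?thesis
    by (simp add: slope_def)
qed

text \<open>Division by \<open>dist x y > 0\<close> bounds each quotient. The sign of
  \<open>c\<close> takes care of the positive part and of the value 0 at isolated points.\<close>

lemma slope_le:
  assumes fin: "\<bar>f x\<bar> \<noteq> \<infinity>" and "0 \<le> c"
    and le: "\<forall>\<^sub>F y in at x. f x \<le> f y + ereal (c * dist x y)"
  shows "slope f x \<le> ereal c"
proof -
  have "\<forall>\<^sub>F y in at x. max 0 (f x - f y) / ereal (dist x y) \<le> ereal c"
    using le eventually_neq_at_within[of x x UNIV]
  proof eventually_elim
    case (elim y)
    then have pos: "0 < dist x y" by simp
    have "max 0 (f x - f y) \<le> ereal (c * dist x y)"
      using elim fin \<open>0 \<le> c\<close> by (cases "f x"; cases "f y") (auto simp: max_def)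
    then show ?case
      using pos by (subst ereal_divide_le_pos) (auto simp: mult.commute)
  qed
  then have "Limsup (at x) (\<lambda>y. max 0 (f x - f y) / ereal (dist x y)) \<le> ereal c"
    by (rule Limsup_bounded)
  with fin \<open>0 \<le> c\<close> show ?thesis
    by (simp add: slope_def)
qed

section \<open>Growth functions of the distance\<close>

lemma growth_function_has_real_derivative:
  assumes "growth_function w" and "0 \<le> t"
  shows "(w has_real_derivative growth_deriv w t) (at t within {0..})"
  using assms unfolding growth_function_def growth_deriv_def differentiable_on_def
  by (simp add: has_real_derivative_iff_has_vector_derivative vector_derivative_works[symmetric])

text \<open>Near \<open>dist z a\<close> the difference quotients of \<open>w\<close> are below
  \<open>c\<close> in absolute value, and the distance to \<open>a\<close> is 1-Lipschitz.\<close>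

lemma growth_function_dist_le:
  fixes a z :: "'a::metric_space"
  assumes w: "growth_function w" and "growth_deriv w (dist z a) < c"
  shows "\<forall>\<^sub>F y in nhds z. w (dist y a) \<le> w (dist z a) + c * dist z y"
proof -
  let ?t = "dist z a"
  let ?q = "\<lambda>s. (w s - w ?t) / (s - ?t)"
  \<comment> \<open>Nonnegativity makes \<open>c\<close> positive and lets it bound the absolute
    value too, so that the distance may grow or shrink.\<close>
  have "growth_deriv w ?t \<ge> 0"
    using w by (cases "?t = 0") (auto simp: growth_function_def less_imp_le)
  then have c: "0 < c" "\<bar>growth_deriv w ?t\<bar> < c"
    using assms(2) by auto
  have "(?q \<longlongrightarrow> growth_deriv w ?t) (at ?t within {0..})"
    using growth_function_has_real_derivative[OF w, of ?t] by (simp add: has_field_derivative_iff)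
  then have "((\<lambda>s. \<bar>?q s\<bar>) \<longlongrightarrow> \<bar>growth_deriv w ?t\<bar>) (at ?t within {0..})"
    by (rule tendsto_rabs)
  then have "\<forall>\<^sub>F s in at ?t within {0..}. \<bar>?q s\<bar> < c"
    using c(2) by (rule order_tendstoD)
  \<comment> \<open>The full neighbourhood filter is used because \<open>dist y a\<close> may equal
    \<open>?t\<close> even when \<open>y\<close> differs from \<open>z\<close>.\<close>
  then have "\<forall>\<^sub>F s in nhds ?t. s \<noteq> ?t \<longrightarrow> 0 \<le> s \<longrightarrow> \<bar>?q s\<bar> < c"
    by (simp add: eventually_at_filter)
  moreover have "((\<lambda>y. dist y a) \<longlongrightarrow> ?t) (nhds z)"
    by (intro tendsto_intros filterlim_ident)
  ultimately have "\<forall>\<^sub>F y in nhds z. dist y a \<noteq> ?t \<longrightarrow> 0 \<le> dist y a \<longrightarrow> \<bar>?q (dist y a)\<bar> < c"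
    by (rule eventually_compose_filterlim)
  then show ?thesis
  proof eventually_elim
    case (elim y)
    show ?case
    proof (cases "dist y a = ?t")
      case True
      then show ?thesis using c(1) by simp
    next
      case False
      with elim have "\<bar>w (dist y a) - w ?t\<bar> \<le> c * \<bar>dist y a - ?t\<bar>"
        by (simp add: abs_divide divide_less_eq)
      also have "\<dots> \<le> c * dist z y"
        using c(1) abs_dist_diff_le[of y a z]
        by (intro mult_left_mono) (simp_all add: dist_commute)
      finally show ?thesis by linarith
    qed
  qed
qed

lemma growth_function_continuous:
  assumes "growth_function w"
  shows "continuous_on {0..} w"
  using assms by (simp add: growth_function_def differentiable_imp_continuous_on)

lemma growth_function_tendsto_0:
  assumes w: "growth_function w" and g: "(g \<longlongrightarrow> 0) F" and "\<And>n. 0 \<le> g n"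
  shows "((\<lambda>n. w (g n)) \<longlongrightarrow> 0) F"
  using continuous_on_tendsto_compose[OF growth_function_continuous[OF w] g] assms
  by (simp add: growth_function_def)

text \<open>The limit from the right says nothing at 0, but the derivative vanishes there; this
  covers indices with \<open>g n = 0\<close>.\<close>

lemma proper_growth_function_deriv_less:
  assumes w: "proper_growth_function w" and "0 < e"
    and g: "(g \<longlongrightarrow> 0) F" and g_nonneg: "\<And>n. 0 \<le> g n"
  shows "\<forall>\<^sub>F n in F. growth_deriv w (g n) < e"
proof -
  have "(growth_deriv w \<longlongrightarrow> 0) (at_right 0)"
    using w by (simp add: proper_growth_function_def)
  then have "\<forall>\<^sub>F s in at_right 0. growth_deriv w s < e"
    using \<open>0 < e\<close> by (rule order_tendstoD)
  then have "\<forall>\<^sub>F s in nhds 0. s \<noteq> 0 \<longrightarrow> 0 < s \<longrightarrow> growth_deriv w s < e"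
    by (simp add: eventually_at_filter)
  then have "\<forall>\<^sub>F n in F. g n \<noteq> 0 \<longrightarrow> 0 < g n \<longrightarrow> growth_deriv w (g n) < e"
    using g by (rule eventually_compose_filterlim)
  then show ?thesis
  proof eventually_elim
    case (elim n)
    have "growth_deriv w 0 = 0"
      using w by (simp add: proper_growth_function_def growth_function_def)
    with elim \<open>0 < e\<close> g_nonneg[of n] show ?case
      by (cases "g n = 0") auto
  qed
qed

section \<open>A point of small slope near a model minimizer\<close>

text \<open>Here \<open>a\<close> is the centre of the model \<open>g\<close> and \<open>p\<close>
  its minimizer. Ekeland's principle is applied to the upper bound \<open>h\<close> of
  \<open>g\<close> rather than to \<open>f\<close>, since the model controls \<open>h\<close> from
  below.\<close>

lemma model_minimizer_nearby_small_slope: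
  fixes f :: "'a::complete_space \<Rightarrow> ereal"
  assumes lsc: "lower_semicontinuous f"
    and w: "growth_function w"
    and model: "\<And>y. g y = \<infinity> \<and> f y = \<infinity> \<or>
           \<bar>g y\<bar> \<noteq> \<infinity> \<and> \<bar>f y\<bar> \<noteq> \<infinity> \<and> \<bar>g y - f y\<bar> \<le> ereal (w (dist y a))"
    and min: "\<And>y. g p \<le> g y"
    and fin: "\<bar>f p\<bar> \<noteq> \<infinity>"
    and \<epsilon>: "0 < \<epsilon>"
  obtains z where "\<bar>f z\<bar> \<noteq> \<infinity>" and "\<epsilon> * dist p z \<le> 2 * w (dist p a)"
    and "f z \<le> f p + ereal (w (dist p a))"
    and "growth_deriv w (dist z a) < \<epsilon> \<Longrightarrow> slope f z \<le> ereal (2 * \<epsilon>)"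
proof -
  define h where "h y = f y + ereal (w (dist y a))" for y
  have w_nonneg: "0 \<le> w (dist y a)" for y
    using w by (simp add: growth_function_def)
  have "continuous_on UNIV (\<lambda>y. w (dist y a))"
    by (rule continuous_on_compose2[OF growth_function_continuous[OF w]])
      (auto intro: continuous_intros)
  with lsc have h_lsc: "lower_semicontinuous h"
    unfolding h_def by (rule lower_semicontinuous_add_real)
  obtain b where b: "f p = ereal b"
    using fin by auto
  \<comment> \<open>The chain is \<open>f p - w (dist p a) \<le> g p \<le> g y \<le> h y\<close>.
    The lower bound falls short of \<open>h p\<close> by \<open>2 * w (dist p a)\<close>, which
    yields the distance estimate below.\<close>
  have h_lower: "ereal (b - w (dist p a)) \<le> h y" for y
    using model[of y] model[of p] min[of y] b unfolding h_def
    by (cases "g p"; cases "g y"; cases "f y") auto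
  have "h p \<noteq> \<infinity>"
    by (simp add: h_def b)
  obtain z where z: "h z + ereal (\<epsilon> * dist p z) \<le> h p"
      "\<And>y. h z \<le> h y + ereal (\<epsilon> * dist z y)"
    using ekeland_variational_principle[OF h_lsc h_lower \<open>h p \<noteq> \<infinity>\<close> \<epsilon>] by blast
  obtain v where v: "f z = ereal v"
    using model[of z] z(1) by (cases "f z") (auto simp: h_def b)
  show thesis
  proof
    show "\<bar>f z\<bar> \<noteq> \<infinity>"
      by (simp add: v)
    show "\<epsilon> * dist p z \<le> 2 * w (dist p a)"
      using z(1) h_lower[of z] by (simp add: h_def b v)
    have "0 \<le> \<epsilon> * dist p z"
      using \<epsilon> by simp
    with z(1) w_nonneg[of z] show "f z \<le> f p + ereal (w (dist p a))"
      by (simp add: h_def b v)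
    assume "growth_deriv w (dist z a) < \<epsilon>"
    then have "\<forall>\<^sub>F y in at z. w (dist y a) \<le> w (dist z a) + \<epsilon> * dist z y"
      using growth_function_dist_le[OF w] by (simp add: eventually_nhds_conv_at)
    \<comment> \<open>One \<open>\<epsilon>\<close> comes from Ekeland's inequality for
      \<open>h\<close>, the other from removing the growth term.\<close>
    then have "\<forall>\<^sub>F y in at z. f z \<le> f y + ereal (2 * \<epsilon> * dist z y)"
    proof eventually_elim
      case (elim y)
      with z(2)[of y] model[of y] show ?case
        by (cases "f y") (auto simp: h_def v)
    qed
    then show "slope f z \<le> ereal (2 * \<epsilon>)"
      using \<epsilon> by (intro slope_le) (auto simp: v)
  qed
qed

section \<open>Bounds for the limiting slope\<close>

lemma limiting_slope_nonneg: "0 \<le> limiting_slope f x"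
  unfolding limiting_slope_def by (intro Liminf_bounded always_eventually allI slope_nonneg)

text \<open>The two convergence assumptions together say that \<open>z\<close> tends to the filter
  defining \<open>limiting_slope\<close>, so a lower limit above \<open>c\<close> would force slopes
  above \<open>c\<close> along \<open>z\<close>.\<close>

lemma limiting_slope_le:
  assumes "F \<noteq> bot" and "(z \<longlongrightarrow> x) F" and "((\<lambda>n. f (z n)) \<longlongrightarrow> f x) F"
    and le: "\<forall>\<^sub>F n in F. slope f (z n) \<le> c"
  shows "limiting_slope f x \<le> c"
proof (rule ccontr)
  assume "\<not> limiting_slope f x \<le> c"
  then have "\<forall>\<^sub>F y in inf (nhds x) (filtercomap f (nhds (f x))). c < slope f y"
    unfolding limiting_slope_def by (intro less_LiminfD) simp
  moreover have "filterlim z (inf (nhds x) (filtercomap f (nhds (f x)))) F"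
    using assms(2,3) by (simp add: filterlim_inf filterlim_filtercomap_iff o_def)
  ultimately have "\<forall>\<^sub>F n in F. c < slope f (z n)"
    by (rule eventually_compose_filterlim)
  then have "\<forall>\<^sub>F n in F. False"
    using le by eventually_elim auto
  with \<open>F \<noteq> bot\<close> show False by simp
qed

section \<open>Stationarity of limit points\<close>

theorem corollary3p3:
  fixes f :: "'a::complete_space \<Rightarrow> ereal"
    and x :: "nat \<Rightarrow> 'a"
    and fx :: "nat \<Rightarrow> 'a \<Rightarrow> ereal"
    and \<omega> :: "real \<Rightarrow> real"
    and xstar :: 'a
  assumes "\<And>y. f y \<noteq> -\<infinity>"
    and "closed_function f"
    and "\<And>k. \<bar>f (x k)\<bar> \<noteq> \<infinity>"
    and "\<And>k y. fx k y \<noteq> -\<infinity>"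
    and "\<And>k. closed_function (fx k)"
    and "\<And>k. is_arg_min (fx k) (\<lambda>_. True) (x (Suc k))"
    and "(\<lambda>k. dist (x (Suc k)) (x k)) \<longlonglongrightarrow> 0"
    and "proper_growth_function \<omega>"
    and "\<And>k y. fx k y = \<infinity> \<and> f y = \<infinity> \<or>
           \<bar>fx k y\<bar> \<noteq> \<infinity> \<and> \<bar>f y\<bar> \<noteq> \<infinity> \<and> \<bar>fx k y - f y\<bar> \<le> ereal (\<omega> (dist y (x k)))"
    and "\<bar>f xstar\<bar> \<noteq> \<infinity>"
    and "\<exists>r. strict_mono (r :: nat \<Rightarrow> nat) \<and>
           (\<lambda>j. (x (r j), f (x (r j)))) \<longlonglongrightarrow> (xstar, f xstar)"
  shows "stationary_point f xstar"
proof -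
  have lsc: "lower_semicontinuous f"
    using assms(2) by (simp add: closed_function_def)
  have w: "growth_function \<omega>"
    using assms(8) by (simp add: proper_growth_function_def)
  have min: "fx k (x (Suc k)) \<le> fx k y" for k y
    using assms(6)[of k] by (simp add: is_arg_min_linorder)
  obtain r where r: "strict_mono (r :: nat \<Rightarrow> nat)"
    and lim: "(\<lambda>j. (x (r j), f (x (r j)))) \<longlonglongrightarrow> (xstar, f xstar)"
    using assms(11) by blast
  \<comment> \<open>\<open>x (Suc (s j))\<close> is the given subsequence without its first term: the model whose minimizer
    is \<open>x (r j)\<close> has index \<open>r j - 1\<close>, which needs \<open>r j > 0\<close>.\<close>
  define s where "s j = r (Suc j) - 1" for j
  have s_Suc: "Suc (s j) = r (Suc j)" for j
    using seq_suble[OF r, of "Suc j"] by (simp add: s_def)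
  have xs: "(\<lambda>j. x (Suc (s j))) \<longlonglongrightarrow> xstar"
    using LIMSEQ_Suc[OF tendsto_fst[OF lim]] by (simp add: s_Suc)
  have fs: "(\<lambda>j. f (x (Suc (s j)))) \<longlonglongrightarrow> f xstar"
    using LIMSEQ_Suc[OF tendsto_snd[OF lim]] by (simp add: s_Suc)
  \<comment> \<open>The shifted indices again form a subsequence, so the step lengths vanish along
    \<open>s\<close>.\<close>
  have "strict_mono s"
    unfolding strict_mono_Suc_iff using r by (metis Suc_less_eq s_Suc strict_mono_Suc_iff)
  then have ds: "(\<lambda>j. dist (x (Suc (s j))) (x (s j))) \<longlonglongrightarrow> 0"
    using LIMSEQ_subseq_LIMSEQ[OF assms(7)] by (simp add: o_def)
  have ws: "(\<lambda>j. \<omega> (dist (x (Suc (s j))) (x (s j)))) \<longlonglongrightarrow> 0"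
    by (rule growth_function_tendsto_0[OF w ds]) simp
  have small: "limiting_slope f xstar \<le> ereal (2 * \<epsilon>)" if \<epsilon>: "0 < \<epsilon>" for \<epsilon>
  proof -
    have "\<exists>z. \<bar>f z\<bar> \<noteq> \<infinity> \<and>
        \<epsilon> * dist (x (Suc k)) z \<le> 2 * \<omega> (dist (x (Suc k)) (x k)) \<and>
        f z \<le> f (x (Suc k)) + ereal (\<omega> (dist (x (Suc k)) (x k))) \<and>
        (growth_deriv \<omega> (dist z (x k)) < \<epsilon> \<longrightarrow> slope f z \<le> ereal (2 * \<epsilon>))" for k
      using model_minimizer_nearby_small_slope[OF lsc w assms(9) min assms(3) \<epsilon>] by metis
    then obtain z where z_dist: "\<And>k. \<epsilon> * dist (x (Suc k)) (z k) \<le> 2 * \<omega> (dist (x (Suc k)) (x k))"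
      and z_le: "\<And>k. f (z k) \<le> f (x (Suc k)) + ereal (\<omega> (dist (x (Suc k)) (x k)))"
      and z_slope: "\<And>k. growth_deriv \<omega> (dist (z k) (x k)) < \<epsilon> \<Longrightarrow> slope f (z k) \<le> ereal (2 * \<epsilon>)"
      by metis
    have dz: "(\<lambda>j. dist (x (Suc (s j))) (z (s j))) \<longlonglongrightarrow> 0"
    proof (rule Lim_null_comparison)
      show "\<forall>\<^sub>F j in sequentially. norm (dist (x (Suc (s j))) (z (s j)))
          \<le> 2 * \<omega> (dist (x (Suc (s j))) (x (s j))) / \<epsilon>"
        using z_dist \<epsilon> by (simp add: le_divide_eq mult.commute)
      show "(\<lambda>j. 2 * \<omega> (dist (x (Suc (s j))) (x (s j))) / \<epsilon>) \<longlonglongrightarrow> 0"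
        by (intro tendsto_divide_zero tendsto_mult_right_zero ws)
    qed
    have zs: "(\<lambda>j. z (s j)) \<longlonglongrightarrow> xstar"
    proof (rule metric_tendsto_imp_tendsto)
      show "(\<lambda>j. dist (x (Suc (s j))) (z (s j)) + dist (x (Suc (s j))) xstar) \<longlonglongrightarrow> 0"
        using tendsto_add[OF dz xs[unfolded tendsto_dist_iff[of _ xstar]]] by simp
      show "\<forall>\<^sub>F j in sequentially. dist (z (s j)) xstar
          \<le> dist (dist (x (Suc (s j))) (z (s j)) + dist (x (Suc (s j))) xstar) 0"
        by (simp add: dist_triangle3)
    qed
    \<comment> \<open>Finiteness of \<open>f xstar\<close> justifies adding the limits in the
      extended reals.\<close>
    have "(\<lambda>j. f (x (Suc (s j))) + ereal (\<omega> (dist (x (Suc (s j))) (x (s j)))))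
        \<longlonglongrightarrow> f xstar + ereal 0"
      using fs assms(10) by (intro tendsto_add_ereal_general2 tendsto_ereal ws) auto
    then have upper: "(\<lambda>j. f (x (Suc (s j))) + ereal (\<omega> (dist (x (Suc (s j))) (x (s j)))))
        \<longlonglongrightarrow> f xstar"
      by (simp add: zero_ereal_def[symmetric])
    \<comment> \<open>Lower semicontinuity bounds the values from below, \<open>z_le\<close> and
      \<open>upper\<close> from above; \<open>f\<close> itself need not be continuous.\<close>
    have fz: "(\<lambda>j. f (z (s j))) \<longlonglongrightarrow> f xstar"
    proof (rule order_tendstoI)
      fix c assume "c < f xstar"
      then show "\<forall>\<^sub>F j in sequentially. c < f (z (s j))"
        using eventually_compose_filterlim[OF lower_semicontinuousD[OF lsc] zs] by blast
    next
      fix c assume "f xstar < c"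
      from order_tendstoD(2)[OF upper this] show "\<forall>\<^sub>F j in sequentially. f (z (s j)) < c"
        by eventually_elim (use z_le le_less_trans in blast)
    qed
    have dzx: "(\<lambda>j. dist (z (s j)) (x (s j))) \<longlonglongrightarrow> 0"
    proof (rule Lim_null_comparison)
      show "\<forall>\<^sub>F j in sequentially. norm (dist (z (s j)) (x (s j)))
          \<le> dist (x (Suc (s j))) (z (s j)) + dist (x (Suc (s j))) (x (s j))"
        by (simp add: dist_triangle3)
      show "(\<lambda>j. dist (x (Suc (s j))) (z (s j)) + dist (x (Suc (s j))) (x (s j))) \<longlonglongrightarrow> 0"
        using tendsto_add[OF dz ds] by simp
    qed
    have "\<forall>\<^sub>F j in sequentially. growth_deriv \<omega> (dist (z (s j)) (x (s j))) < \<epsilon>"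
      by (rule proper_growth_function_deriv_less[OF assms(8) \<epsilon> dzx]) simp
    then have "\<forall>\<^sub>F j in sequentially. slope f (z (s j)) \<le> ereal (2 * \<epsilon>)"
      by (rule eventually_mono) (rule z_slope)
    then show ?thesis
      by (intro limiting_slope_le[OF _ zs fz]) simp_all
  qed
  have "limiting_slope f xstar \<le> 0"
  proof (rule ereal_le_epsilon2)
    fix e :: real assume "0 < e"
    then show "limiting_slope f xstar \<le> 0 + ereal e"
      \<comment> \<open>Halving \<open>e\<close> absorbs the factor 2 in
        \<open>small\<close>.\<close>
      using small[of "e / 2"] by simp
  qed
  then show ?thesis
    using assms(10) limiting_slope_nonneg[of f xstar] by (simp add: stationary_point_def)
qed

end
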